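(* Let $(V_h,d)$ be a family of finite-dimensional subcomplexes of the domain complex $(V,d)$ of a closed Hilbert complex $(W,d)$, parametrized by $h$ and admitting uniformly $V$-bounded cochain projections $\pi_h$. Fix $k$ and $f\in W^k$. Let $(\sigma,u,p)\in V^{k-1}\times V^k\times\mathfrak H^k$ be the solution of $$\begin{aligned}\langle\sigma,\tau\rangle-\langle d\tau,u\rangle&=0, &&\tau\in V^{k-1},\\ \langle d\sigma,v\rangle+\langle du,dv\rangle+\langle v,p\rangle&=\langle f,v\rangle, &&v\in V^k,\\ \langle u,q\rangle&=0,&&q\in\mathfrak H^k,\end{aligned}$$ and let $(\sigma_h,u_h,p_h)\in V_h^{k-1}\times V_h^k\times\mathfrak H_h^k$ be the solution of the same system with $V^{k-1},V^k,\mathfrak H^k$ replaced by $V_h^{k-1},V_h^k,\mathfrak H_h^k$. Then $$\|\sigma-\sigma_h\|_V+\|u-u_h\|_V+\|p-p_h\|\le C\Bigl(\inf_{\tau\in V_h^{k-1}}\|\sigma-\tau\|_V+\inf_{v\in V_h^k}\|u-v\|_V+\inf_{q\in V_h^k}\|p-q\|_V+\mu\inf_{v\in V_h^k}\|P_{\mathfrak B}u-v\|_V\Bigr),$$ where $C$ is independent of $h$ and $f$ and $$\mu=\mu_h^k=\sup_{r\in\mathfrak H^k,\ \|r\|=1}\|(I-\pi_h^k)r\|.$$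
   Context: A Hilbert complex $(W,d)$ is a finite sequence of real Hilbert spaces $W^k$ and closed, densely defined operators $d^k$ from $W^k$ to $W^{k+1}$ such that the range of $d^k$ lies in the domain of $d^{k+1}$ and $d^{k+1}\circ d^k=0$; it is closed if every $d^k$ has closed range. The domain complex $(V,d)$ has $V^k=$ domain of $d^k$ with the graph inner product $\langle u,v\rangle_V=\langle u,v\rangle_{W^k}+\langle d^ku,d^kv\rangle_{W^{k+1}}$. Unsubscripted $\langle\cdot,\cdot\rangle$, $\|\cdot\|$ are those of $W^k$. $\mathfrak Z^k=\ker d^k$, $\mathfrak B^k=$ range of $d^{k-1}$, $\mathfrak H^k=\mathfrak Z^k\cap(\mathfrak B^k)^\perp$, and $P_{\mathfrak B}$ is the $W^k$-orthogonal projection onto $\mathfrak B^k$. A subcomplex consists of subspaces $V_h^k\subset V^k$ with $dV_h^k\subset V_h^{k+1}$; $\mathfrak Z_h^k=\ker(d|_{V_h^k})$, $\mathfrak B_h^k=dV_h^{k-1}$, $\mathfrak H_h^k=\mathfrak Z_h^k\cap(\mathfrak B_h^k)^\perp$. A cochain projection $\pi_h$ is a collection of linear maps $\pi_h^k:V^k\to V_h^k$ restricting to the identity on $V_h^k$ with $d^k\pi_h^k=\pi_h^{k+1}d^k$; uniformly $V$-bounded means $\|\pi_h^kv\|_V\le c\|v\|_V$ with $c$ independent of $h$. Both systems have unique solutions. The supremum over an empty set is $0$. *)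

theory Defs
  imports "HOL-Analysis.Analysis"
begin

text \<open>
  A Hilbert complex is indexed by the integers, with only finitely many nonzero spaces; a finite
  sequence of spaces is extended by zero, so that for instance \<open>V (k - 1)\<close> always makes sense.
  The spaces \<open>W k\<close> are complete subspaces, with the induced inner product, of one real inner
  product space \<open>'a\<close>.  No relation between \<open>W k\<close> and \<open>W l\<close> is assumed for \<open>k \<noteq> l\<close>, and every finite
  sequence of Hilbert spaces has this form (inside its orthogonal direct sum).  The operator \<open>d k\<close>
  is a total function of which only the values on its domain \<open>V k\<close> matter.
\<close>

definition linear_map_on :: "'a::real_vector set \<Rightarrow> ('a \<Rightarrow> 'b::real_vector) \<Rightarrow> bool" where
  "linear_map_on S f \<longleftrightarrow>
     (\<forall>x\<in>S. \<forall>y\<in>S. f (x + y) = f x + f y) \<and> (\<forall>c. \<forall>x\<in>S. f (c *\<^sub>R x) = c *\<^sub>R f x)"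

locale hilbert_complex =
  fixes W :: "int \<Rightarrow> 'a::real_inner set"
    and V :: "int \<Rightarrow> 'a set"
    and d :: "int \<Rightarrow> 'a \<Rightarrow> 'a"
  assumes finite_sequence: "finite {k. W k \<noteq> {0}}"
    and subspace_W: "subspace (W k)"
    and complete_W: "complete (W k)"
    and subspace_V: "subspace (V k)"
    and domain_subset: "V k \<subseteq> W k"
    and domain_dense: "W k \<subseteq> closure (V k)"
    and linear_d: "linear_map_on (V k) (d k)"
    and range_subset_domain: "d k ` V k \<subseteq> V (k + 1)"
    and closed_graph: "closed {(v, d k v) | v. v \<in> V k}"
    and d_d_zero: "v \<in> V k \<Longrightarrow> d (k + 1) (d k v) = 0"

locale closed_hilbert_complex = hilbert_complex +
  assumes closed_range: "closed (d k ` V k)"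

definition inner_V :: "(int \<Rightarrow> 'a::real_inner \<Rightarrow> 'a) \<Rightarrow> int \<Rightarrow> 'a \<Rightarrow> 'a \<Rightarrow> real" where
  "inner_V d k u v = u \<bullet> v + d k u \<bullet> d k v"

definition norm_V :: "(int \<Rightarrow> 'a::real_inner \<Rightarrow> 'a) \<Rightarrow> int \<Rightarrow> 'a \<Rightarrow> real" where
  "norm_V d k v = sqrt (inner_V d k v v)"

text \<open>
  In the next three definitions \<open>U\<close> is either the domain complex \<open>V\<close> or a subcomplex of it.
\<close>

definition cycles :: "(int \<Rightarrow> 'a::real_inner \<Rightarrow> 'a) \<Rightarrow> (int \<Rightarrow> 'a set) \<Rightarrow> int \<Rightarrow> 'a set" where
  "cycles d U k = {z \<in> U k. d k z = 0}"

definition boundaries :: "(int \<Rightarrow> 'a::real_inner \<Rightarrow> 'a) \<Rightarrow> (int \<Rightarrow> 'a set) \<Rightarrow> int \<Rightarrow> 'a set" where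
  "boundaries d U k = d (k - 1) ` U (k - 1)"

definition harmonics :: "(int \<Rightarrow> 'a::real_inner \<Rightarrow> 'a) \<Rightarrow> (int \<Rightarrow> 'a set) \<Rightarrow> int \<Rightarrow> 'a set" where
  "harmonics d U k = cycles d U k \<inter> (boundaries d U k)\<^sup>\<bottom>"

definition orth_proj :: "'a::real_inner set \<Rightarrow> 'a \<Rightarrow> 'a" where
  "orth_proj S x = (THE y. y \<in> S \<and> x - y \<in> S\<^sup>\<bottom>)"

locale fin_dim_subcomplex = hilbert_complex W V d
  for W V :: "int \<Rightarrow> 'a::real_inner set" and d :: "int \<Rightarrow> 'a \<Rightarrow> 'a" +
  fixes Vh :: "int \<Rightarrow> 'a set"
  assumes subspace_Vh: "subspace (Vh k)"
    and finite_dim_Vh: "\<exists>b. finite b \<and> Vh k = span b"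
    and Vh_subset: "Vh k \<subseteq> V k"
    and d_Vh_subset: "d k ` Vh k \<subseteq> Vh (k + 1)"

locale cochain_projection = fin_dim_subcomplex W V d Vh
  for W V :: "int \<Rightarrow> 'a::real_inner set" and d :: "int \<Rightarrow> 'a \<Rightarrow> 'a" and Vh :: "int \<Rightarrow> 'a set" +
  fixes \<pi> :: "int \<Rightarrow> 'a \<Rightarrow> 'a"
  assumes linear_proj: "linear_map_on (V k) (\<pi> k)"
    and proj_into: "\<pi> k ` V k \<subseteq> Vh k"
    and proj_id: "v \<in> Vh k \<Longrightarrow> \<pi> k v = v"
    and proj_commutes: "v \<in> V k \<Longrightarrow> d k (\<pi> k v) = \<pi> (k + 1) (d k v)"

definition uniformly_V_bounded ::
  "(int \<Rightarrow> 'a::real_inner set) \<Rightarrow> (int \<Rightarrow> 'a \<Rightarrow> 'a) \<Rightarrow> ('h \<Rightarrow> int \<Rightarrow> 'a \<Rightarrow> 'a) \<Rightarrow> bool" where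
  "uniformly_V_bounded V d \<pi> \<longleftrightarrow>
     (\<forall>k. \<exists>c. \<forall>h. \<forall>v\<in>V k. norm_V d k (\<pi> h k v) \<le> c * norm_V d k v)"

definition mixed_solution ::
  "(int \<Rightarrow> 'a::real_inner \<Rightarrow> 'a) \<Rightarrow> (int \<Rightarrow> 'a set) \<Rightarrow> int \<Rightarrow> 'a \<Rightarrow> 'a \<Rightarrow> 'a \<Rightarrow> 'a \<Rightarrow> bool" where
  "mixed_solution d U k f \<sigma> u p \<longleftrightarrow>
     \<sigma> \<in> U (k - 1) \<and> u \<in> U k \<and> p \<in> harmonics d U k \<and>
     (\<forall>\<tau>\<in>U (k - 1). \<sigma> \<bullet> \<tau> - d (k - 1) \<tau> \<bullet> u = 0) \<and>
     (\<forall>v\<in>U k. d (k - 1) \<sigma> \<bullet> v + d k u \<bullet> d k v + v \<bullet> p = f \<bullet> v) \<and>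
     (\<forall>q\<in>harmonics d U k. u \<bullet> q = 0)"

text \<open>
  The supremum over the empty set is 0 by convention; \<open>Sup {}\<close> is unspecified for reals.
  For a bounded projection \<open>\<pi>\<close> the set of norms is bounded above, since \<open>d k r = 0\<close> for harmonic \<open>r\<close>.
\<close>

definition harmonic_gap ::
  "(int \<Rightarrow> 'a::real_inner set) \<Rightarrow> (int \<Rightarrow> 'a \<Rightarrow> 'a) \<Rightarrow> (int \<Rightarrow> 'a \<Rightarrow> 'a) \<Rightarrow> int \<Rightarrow> real" where
  "harmonic_gap V d \<pi> k =
     (let R = {r \<in> harmonics d V k. norm r = 1}
      in if R = {} then 0 else SUP r\<in>R. norm (r - \<pi> k r))"

end

theory Submission
  imports Defs
begin

text \<open>
  A closed operator with closed range has, by the Baire category theorem, a bounded right inverse;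
  composing it with the cochain projections gives right inverses of the discrete differentials with
  a bound independent of \<open>h\<close>.  With them the errors can be estimated one after the other, by testing
  the difference of the two systems: first \<open>d \<sigma>\<close> (its discrete value is the orthogonal projection
  onto the discrete boundaries), then \<open>p\<close>, then \<open>d u\<close>, and finally \<open>u\<close> and \<open>\<sigma>\<close>
  together.  In the discrete Hodge decomposition of the error of \<open>u\<close>, the harmonic part is controlled
  by \<open>\<langle>u, q\<rangle>\<close> for discrete harmonic \<open>q\<close>.  If \<open>b\<close> is the boundary part of \<open>q\<close> and
  \<open>y\<close> that of \<open>u\<close>, then \<open>\<langle>u, q\<rangle> = \<langle>y - \<pi> y, b\<rangle>\<close> and \<open>\<parallel>b\<parallel> \<le> \<mu> \<parallel>q\<parallel>\<close>, which yields the
  factor \<open>\<mu>\<close>.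
\<close>

section \<open>Orthogonal projections and linear maps on subspaces\<close>

text \<open>Cancels one factor \<open>norm x\<close>. Several error components below are tested with
  themselves, which yields exactly this shape; \<open>0 \<le> t\<close> covers
  \<open>x = 0\<close>.\<close>

lemma norm_le_if_inner_le:
  fixes x :: "'a::real_inner"
  assumes "x \<bullet> x \<le> norm x * t" "0 \<le> t"
  shows "norm x \<le> t"
proof (cases "x = 0")
  case False
  then show ?thesis
    using assms(1) by (simp add: dot_square_norm power2_eq_square)
qed (use assms in auto)

text \<open>Pythagoras. It serves below as the best-approximation property of orthogonal
  projections.\<close>

lemma norm_diff_le_if_orthogonal:
  fixes x y :: "'a::real_inner"
  assumes "x \<bullet> y = 0"
  shows "norm x \<le> norm (x - y)"
  using assms by (simp add: norm_le inner_diff inner_commute)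

lemma orthogonal_compD: "x \<in> S\<^sup>\<bottom> \<Longrightarrow> y \<in> S \<Longrightarrow> x \<bullet> y = 0"
  by (auto simp: orthogonal_comp_def orthogonal_def inner_commute)

lemma orthogonal_compI: "(\<And>y. y \<in> S \<Longrightarrow> x \<bullet> y = 0) \<Longrightarrow> x \<in> S\<^sup>\<bottom>"
  by (auto simp: orthogonal_comp_def orthogonal_def inner_commute)

text \<open>Two candidates differ by an element of \<open>S\<close> that is orthogonal to itself, so
  the definite description is determined.\<close>

lemma orth_proj_eqI:
  assumes S: "subspace S" and y: "y \<in> S" "x - y \<in> S\<^sup>\<bottom>"
  shows "orth_proj S x = y"
  unfolding orth_proj_def
proof (rule the_equality)
  fix z assume z: "z \<in> S \<and> x - z \<in> S\<^sup>\<bottom>"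
  then have "z - y \<in> S"
    using S y by (simp add: subspace_diff)
  then have "(x - y) \<bullet> (z - y) = 0" "(x - z) \<bullet> (z - y) = 0"
    using y z by (auto intro: orthogonal_compD)
  then have "(z - y) \<bullet> (z - y) = 0"
    by (simp add: inner_diff_left)
  then show "z = y"
    by simp
qed (use y in simp)

text \<open>A minimising sequence for the distance from \<open>x\<close> to \<open>S\<close> is
  Cauchy by the parallelogram law. Completeness is asked of \<open>S\<close> alone because the
  ambient space may be incomplete.\<close>

lemma exists_orth_proj_complete:
  fixes S :: "'a::real_inner set"
  assumes S: "subspace S" and "complete S"
  shows "\<exists>y\<in>S. x - y \<in> S\<^sup>\<bottom>"
proof -
  define m where "m = (INF y\<in>S. (norm (x - y))\<^sup>2)"
  have bdd: "bdd_below ((\<lambda>y. (norm (x - y))\<^sup>2) ` S)"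
    by (rule bdd_belowI[of _ 0]) auto
  have ne: "S \<noteq> {}"
    using S subspace_0 by blast
  have m_le: "m \<le> (norm (x - y))\<^sup>2" if "y \<in> S" for y
    unfolding m_def by (rule cINF_lower[OF bdd that])
  have "\<exists>y\<in>S. (norm (x - y))\<^sup>2 < m + inverse (real (Suc n))" for n
    using cINF_less_iff[OF ne bdd, of "m + inverse (real (Suc n))"] by (simp add: m_def)
  then obtain s where s: "\<And>n. s n \<in> S"
      "\<And>n. (norm (x - s n))\<^sup>2 < m + inverse (real (Suc n))"
    by metis
  \<comment> \<open>Parallelogram law: the midpoint of \<open>y\<close> and \<open>z\<close> lies in
    \<open>S\<close>, so its squared distance from \<open>x\<close> is at least
    \<open>m\<close>.\<close>
  have mid: "(norm (y - z))\<^sup>2 \<le> 2 * ((norm (x - y))\<^sup>2 - m) + 2 * ((norm (x - z))\<^sup>2 - m)"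
    if "y \<in> S" "z \<in> S" for y z
  proof -
    have "(1/2) *\<^sub>R (y + z) \<in> S"
      using S that by (simp add: subspace_add subspace_scale)
    then have "m \<le> (norm (x - (1/2) *\<^sub>R (y + z)))\<^sup>2"
      by (rule m_le)
    moreover have "(norm (y - z))\<^sup>2 =
        2 * (norm (x - y))\<^sup>2 + 2 * (norm (x - z))\<^sup>2 - 4 * (norm (x - (1/2) *\<^sub>R (y + z)))\<^sup>2"
      unfolding power2_norm_eq_inner by (simp add: inner_commute algebra_simps)
    ultimately show ?thesis
      by (smt (verit))
  qed
  have "Cauchy s"
  proof (rule metric_CauchyI)
    fix e :: real assume "0 < e"
    \<comment> \<open>The bound \<open>mid\<close> counts each of the two excesses over
      \<open>m\<close> twice, hence the quarter.\<close>
    obtain N where N: "inverse (real (Suc N)) < e\<^sup>2 / 4"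
      using reals_Archimedean[of "e\<^sup>2 / 4"] \<open>0 < e\<close> by auto
    have "dist (s i) (s j) < e" if "N \<le> i" "N \<le> j" for i j
    proof -
      have "inverse (real (Suc i)) \<le> inverse (real (Suc N))"
          "inverse (real (Suc j)) \<le> inverse (real (Suc N))"
        using that by (simp_all add: field_simps)
      then have "(norm (s i - s j))\<^sup>2 < 4 * (e\<^sup>2 / 4)"
        using mid[OF s(1)[of i] s(1)[of j]] s(2)[of i] s(2)[of j] N by (smt (verit))
      then have "(norm (s i - s j))\<^sup>2 < e\<^sup>2"
        by simp
      then show ?thesis
        using \<open>0 < e\<close> by (simp add: dist_norm power2_less_imp_less)
    qed
    then show "\<exists>M. \<forall>i\<ge>M. \<forall>j\<ge>M. dist (s i) (s j) < e"
      by blast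
  qed
  then obtain y where y: "y \<in> S" "s \<longlonglongrightarrow> y"
    using \<open>complete S\<close> s(1) unfolding complete_def by blast
  have "(norm (x - y))\<^sup>2 \<le> m + 0"
  proof (rule LIMSEQ_le)
    show "(\<lambda>n. (norm (x - s n))\<^sup>2) \<longlonglongrightarrow> (norm (x - y))\<^sup>2"
      by (intro tendsto_intros y)
    show "(\<lambda>n. m + inverse (real (Suc n))) \<longlonglongrightarrow> m + 0"
      by (intro tendsto_intros LIMSEQ_inverse_real_of_nat)
  qed (use s(2) less_imp_le in blast)
  then have min: "(norm (x - y))\<^sup>2 \<le> (norm (x - z))\<^sup>2" if "z \<in> S" for z
    by (intro order_trans[OF _ m_le[OF that]]) simp
  have "(x - y) \<bullet> v = 0" if v: "v \<in> S" for v
  proof (cases "v = 0")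
    case False
    \<comment> \<open>This \<open>t\<close> minimises the distance from \<open>x\<close> along the
      line through \<open>y\<close> in direction \<open>v\<close>; a nonzero inner product would
      push it below the minimum.\<close>
    define t where "t = ((x - y) \<bullet> v) / (v \<bullet> v)"
    have "y + t *\<^sub>R v \<in> S"
      using S y v by (simp add: subspace_add subspace_scale)
    from min[OF this] have "0 \<le> t * t * (v \<bullet> v) - 2 * t * ((x - y) \<bullet> v)"
      unfolding power2_norm_eq_inner by (simp add: inner_commute algebra_simps)
    also have "\<dots> = - (((x - y) \<bullet> v)\<^sup>2 / (v \<bullet> v))"
      using False by (simp add: t_def field_simps power2_eq_square)
    finally have "((x - y) \<bullet> v)\<^sup>2 / (v \<bullet> v) \<le> 0"
      by simp
    then show ?thesis
      using False by (metis divide_pos_pos inner_gt_zero_iff not_le zero_less_power2)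
  qed simp
  then show ?thesis
    using y by (blast intro: orthogonal_compI)
qed

text \<open>Gram-Schmidt, one generator at a time: \<open>n\<close> is the part of the new generator
  orthogonal to the old span, and the old projection is corrected along \<open>n\<close>.\<close>

lemma exists_orth_proj_span:
  fixes b :: "'a::real_inner set"
  assumes "finite b"
  shows "\<exists>y\<in>span b. x - y \<in> (span b)\<^sup>\<bottom>"
  using assms
proof (induction b arbitrary: x rule: finite_induct)
  case empty
  then show ?case
    by (auto intro: orthogonal_compI)
next
  case (insert a b)
  obtain y where y: "y \<in> span b" "x - y \<in> (span b)\<^sup>\<bottom>"
    using insert.IH by blast
  obtain a' where a': "a' \<in> span b" "a - a' \<in> (span b)\<^sup>\<bottom>"
    using insert.IH by blast
  define n where "n = a - a'"
  \<comment> \<open>If \<open>a\<close> already lies in the old span, then \<open>n = 0\<close> and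
    division by zero gives \<open>t = 0\<close>; the next identity holds either way.\<close>
  define t where "t = ((x - y) \<bullet> n) / (n \<bullet> n)"
  have t: "(x - y) \<bullet> n = t * (n \<bullet> n)"
    by (cases "n = 0") (simp_all add: t_def)
  have "n \<in> span (insert a b)"
    using a' unfolding n_def by (metis insertI1 span_base span_diff span_mono subsetD subset_insertI)
  moreover have "y \<in> span (insert a b)"
    using y span_mono[of b "insert a b"] by blast
  ultimately have "y + t *\<^sub>R n \<in> span (insert a b)"
    by (simp add: span_add span_scale)
  moreover have "x - (y + t *\<^sub>R n) \<in> (span (insert a b))\<^sup>\<bottom>"
  proof (rule orthogonal_compI)
    fix z assume "z \<in> span (insert a b)"
    then obtain c where c: "z - c *\<^sub>R a \<in> span b"
      by (auto simp: span_insert)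
    define w where "w = z - c *\<^sub>R n"
    have "w = (z - c *\<^sub>R a) + c *\<^sub>R a'"
      by (simp add: w_def n_def algebra_simps)
    then have "w \<in> span b"
      using c a' by (simp add: span_add span_scale)
    then have "(x - y) \<bullet> w = 0" "n \<bullet> w = 0"
      using y a' by (auto simp: n_def intro: orthogonal_compD)
    moreover have "z = w + c *\<^sub>R n"
      by (simp add: w_def)
    moreover have "(x - (y + t *\<^sub>R n)) \<bullet> n = 0"
      using t by (simp add: algebra_simps)
    ultimately show "(x - (y + t *\<^sub>R n)) \<bullet> z = 0"
      by (simp add: algebra_simps)
  qed
  ultimately show ?case
    by blast
qed

text \<open>A maximal independent subset of \<open>S\<close> is a finite basis. This form suits the
  discrete boundaries, which are known only as a subspace of \<open>Vh k\<close>.\<close>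

lemma exists_orth_proj_finite_dim:
  fixes S :: "'a::real_inner set"
  assumes S: "subspace S" and "finite b" "S \<subseteq> span b"
  shows "\<exists>y\<in>S. x - y \<in> S\<^sup>\<bottom>"
proof -
  obtain s where s: "s \<subseteq> S" "independent s" "S \<subseteq> span s"
    using maximal_independent_subset by blast
  then have "finite s"
    using assms independent_span_bound[of b s] by blast
  moreover have "span s = S"
    using s S by (meson span_minimal subset_antisym)
  ultimately show ?thesis
    using exists_orth_proj_span by blast
qed

section \<open>Maps that are linear on a subspace only\<close>

lemma linear_map_on_zero: "linear_map_on S f \<Longrightarrow> subspace S \<Longrightarrow> f 0 = 0"
  unfolding linear_map_on_def by (metis scaleR_zero_left subspace_0)

lemma linear_map_on_add: "linear_map_on S f \<Longrightarrow> x \<in> S \<Longrightarrow> y \<in> S \<Longrightarrow> f (x + y) = f x + f y"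
  unfolding linear_map_on_def by blast

lemma linear_map_on_scale: "linear_map_on S f \<Longrightarrow> x \<in> S \<Longrightarrow> f (c *\<^sub>R x) = c *\<^sub>R f x"
  unfolding linear_map_on_def by blast

lemma linear_map_on_diff:
  assumes "linear_map_on S f" "subspace S" "x \<in> S" "y \<in> S"
  shows "f (x - y) = f x - f y"
proof -
  have "(-1) *\<^sub>R y \<in> S"
    using assms by (simp only: subspace_scale)
  then have "f (x + (-1) *\<^sub>R y) = f x + (-1) *\<^sub>R f y"
    using assms by (simp only: linear_map_on_add linear_map_on_scale)
  then show ?thesis
    by simp
qed

lemma linear_map_on_sum:
  assumes "linear_map_on S f" "subspace S" "\<And>i. i \<in> I \<Longrightarrow> x i \<in> S"
  shows "f (sum x I) = (\<Sum>i\<in>I. f (x i))"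
  using assms(3)
  by (induction I rule: infinite_finite_induct)
    (simp_all add: linear_map_on_zero[OF assms(1,2)] linear_map_on_add[OF assms(1)]
      subspace_sum[OF assms(2)])

lemma linear_map_on_subset: "linear_map_on S f \<Longrightarrow> T \<subseteq> S \<Longrightarrow> linear_map_on T f"
  unfolding linear_map_on_def by blast

lemma subspace_image_linear_map_on:
  assumes f: "linear_map_on S f" and S: "subspace S"
  shows "subspace (f ` S)"
proof (rule subspaceI)
  show "0 \<in> f ` S"
    using linear_map_on_zero[OF f S] subspace_0[OF S] by (metis imageI)
next
  fix x y assume "x \<in> f ` S" "y \<in> f ` S"
  then show "x + y \<in> f ` S"
    using linear_map_on_add[OF f] subspace_add[OF S] by (smt (verit) image_iff)
next
  fix c x assume "x \<in> f ` S"
  then show "c *\<^sub>R x \<in> f ` S"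
    using linear_map_on_scale[OF f] subspace_scale[OF S] by (smt (verit) image_iff)
qed

section \<open>Closed operators with closed range\<close>

text \<open>Baire's theorem for \<open>B\<close> as a metric space of its own, since the surrounding
  type need not be complete. If no closure contained a relative ball, \<open>B\<close> would be a
  countable union of nowhere dense sets.\<close>

lemma Baire_complete_subset:
  fixes B :: "'a::metric_space set"
  assumes "complete B" "b \<in> B" "B \<subseteq> (\<Union>n::nat. A n)"
  shows "\<exists>n. \<exists>b\<in>B. \<exists>\<rho>>0. B \<inter> ball b \<rho> \<subseteq> closure (A n)"
proof (rule ccontr)
  assume contra: "\<not> ?thesis"
  interpret B: Metric_space B dist
    by (simp add: Metric_space.subspace[OF Met_TC.Metric_space_axioms])
  have mb: "B.mball x r = B \<inter> ball x r" if "x \<in> B" for x r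
    using that by (auto simp: B.mball_def)
  have top: "B.mtopology = top_of_set B"
    using Submetric.mtopology_submetric[of UNIV dist B]
    by (simp add: Submetric_def Submetric_axioms_def Met_TC.Metric_space_axioms)
  have "B.mcomplete"
    unfolding B.mcomplete_def
  proof (intro allI impI)
    fix s assume s: "B.MCauchy s"
    then have "Cauchy s" "range s \<subseteq> B"
      by (auto simp: B.MCauchy_def Cauchy_def)
    then obtain l where "l \<in> B" "s \<longlonglongrightarrow> l"
      using \<open>complete B\<close> unfolding complete_def by (metis rangeI subsetD)
    moreover have "eventually (\<lambda>n. s n \<in> B) sequentially"
      using \<open>range s \<subseteq> B\<close> by (intro always_eventually) blast
    ultimately have "limitin B.mtopology s l sequentially"
      unfolding top by (simp add: limitin_subtopology)
    then show "\<exists>x. limitin B.mtopology s x sequentially"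
      by blast
  qed
  moreover have "closedin B.mtopology T \<and> B.mtopology interior_of T = {}"
    if T: "T \<in> range (\<lambda>n. B \<inter> closure (A n))" for T
  proof
    obtain n where n: "T = B \<inter> closure (A n)"
      using T by blast
    then show "closedin B.mtopology T"
      unfolding top by (simp add: closedin_closed_Int)
    show "B.mtopology interior_of T = {}"
    proof (rule equals0I)
      fix x assume "x \<in> B.mtopology interior_of T"
      then obtain U where U: "openin B.mtopology U" "x \<in> U" "U \<subseteq> T"
        by (auto simp: interior_of_def)
      then obtain r where r: "r > 0" "B.mball x r \<subseteq> U"
        by (auto simp: B.openin_mtopology)
      have "x \<in> B"
        using U n by blast
      with r U n mb[OF this, of r] show False
        using contra by blast
    qed
  qed
  ultimately have "B.mtopology interior_of \<Union>(range (\<lambda>n. B \<inter> closure (A n))) = {}"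
    by (intro B.metric_Baire_category_alt) auto
  moreover have "\<Union>(range (\<lambda>n. B \<inter> closure (A n))) = B"
    using assms(3) closure_subset[of "A _"] by blast
  moreover have "B.mtopology interior_of B = B"
    using interior_of_topspace[of B.mtopology] by simp
  ultimately show False
    using \<open>b \<in> B\<close> by (simp only: empty_iff)
qed

lemma Cauchy_if_geometric_increments:
  fixes s :: "nat \<Rightarrow> 'a::real_normed_vector"
  assumes "\<And>n. norm (z n) \<le> C * (1/2) ^ n"
  shows "Cauchy (\<lambda>n. \<Sum>i<n. z i)"
proof (rule CauchyI)
  fix e :: real assume "0 < e"
  have "summable (\<lambda>n. C * (1/2) ^ n :: real)"
    by (intro summable_mult summable_geometric) simp
  then have "summable (\<lambda>n. norm (z n))"
    by (rule summable_comparison_test'[where N = 0]) (use assms in simp)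
  then obtain N where N: "\<And>m n. m \<ge> N \<Longrightarrow> norm (\<Sum>i=m..<n. norm (z i)) < e"
    using \<open>0 < e\<close> unfolding summable_Cauchy by blast
  have *: "norm ((\<Sum>i<n. z i) - (\<Sum>i<m. z i)) < e" if "N \<le> m" "m \<le> n" for m n
  proof -
    have "(\<Sum>i<n. z i) - (\<Sum>i<m. z i) = (\<Sum>i=m..<n. z i)"
      using that by (simp add: lessThan_atLeast0 sum_diff_nat_ivl)
    also have "norm \<dots> \<le> (\<Sum>i=m..<n. norm (z i))"
      by (rule norm_sum)
    also have "\<dots> < e"
      using N[OF \<open>N \<le> m\<close>, of n] by simp
    finally show ?thesis .
  qed
  show "\<exists>M. \<forall>m\<ge>M. \<forall>n\<ge>M. norm ((\<Sum>i<m. z i) - (\<Sum>i<n. z i)) < e"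
    using * by (metis nle_le norm_minus_commute)
qed

text \<open>The open mapping argument for a closed operator: Baire yields approximate preimages that
  halve the residual, iteration sums them to an exact preimage, and the closed graph identifies the
  limit.\<close>

lemma bounded_right_inverse:
  fixes f :: "'a::real_inner \<Rightarrow> 'b::real_inner"
  assumes S: "subspace S" "S \<subseteq> H" "complete H" and f: "linear_map_on S f"
    and cl: "closed {(v, f v) | v. v \<in> S}" and B: "complete (f ` S)"
  shows "\<exists>K. \<forall>b\<in>f ` S. \<exists>z\<in>S. f z = b \<and> norm z \<le> K * norm b"
proof -
  define A where "A n = f ` {z \<in> S. norm z \<le> real n}" for n :: nat
  have sub: "subspace (f ` S)"
    by (rule subspace_image_linear_map_on[OF f S(1)])
  have "f ` S \<subseteq> (\<Union>n. A n)"
    unfolding A_def using real_arch_simple by blast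
  then obtain n b0 \<rho> where b0: "b0 \<in> f ` S" "\<rho> > 0" "f ` S \<inter> ball b0 \<rho> \<subseteq> closure (A n)"
    using Baire_complete_subset[OF B subspace_0[OF sub]] by metis
  \<comment> \<open>A difference of two preimages of norm at most \<open>n\<close>, divided by the
    scaling \<open>t = \<rho> / (2 * norm b)\<close> used below, has norm at most
    \<open>M * norm b\<close>.\<close>
  define M where "M = 4 * real n / \<rho>"
  have "0 \<le> M"
    using b0 by (simp add: M_def)
  have approx: "\<exists>z\<in>S. norm z \<le> M * norm b \<and> norm (b - f z) \<le> norm b / 2"
    if b: "b \<in> f ` S" for b
  proof (cases "b = 0")
    case True
    then show ?thesis
      using linear_map_on_zero[OF f S(1)] subspace_0[OF S(1)] by (intro bexI[of _ 0]) auto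
  next
    case False
    define t where "t = \<rho> / (2 * norm b)"
    have t: "t > 0"
      using False b0 by (simp add: t_def)
    have "b0 + t *\<^sub>R b \<in> f ` S"
      using sub b b0 by (simp add: subspace_add subspace_scale)
    moreover have "dist b0 (b0 + t *\<^sub>R b) < \<rho>"
      using False b0 t by (simp add: dist_norm t_def)
    ultimately have "b0 + t *\<^sub>R b \<in> closure (A n)" "b0 \<in> closure (A n)"
      using b0 by auto
    \<comment> \<open>Two errors of \<open>\<rho> / 8\<close> add up to \<open>\<rho> / 4\<close>,
      which becomes \<open>norm b / 2\<close> after division by \<open>t\<close>.\<close>
    moreover have "0 < \<rho> / 8"
      using b0 by simp
    ultimately obtain a1 a2 where a: "a1 \<in> A n" "dist a1 (b0 + t *\<^sub>R b) < \<rho> / 8"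
        "a2 \<in> A n" "dist a2 b0 < \<rho> / 8"
      unfolding closure_approachable by metis
    then obtain z1 z2 where z: "z1 \<in> S" "norm z1 \<le> real n" "a1 = f z1"
        "z2 \<in> S" "norm z2 \<le> real n" "a2 = f z2"
      unfolding A_def by blast
    define z where "z = (1 / t) *\<^sub>R (z1 - z2)"
    have "z \<in> S"
      unfolding z_def using S z by (simp add: subspace_diff subspace_scale)
    moreover have "norm z \<le> M * norm b"
    proof -
      have "norm (z1 - z2) \<le> 2 * real n"
        using z norm_triangle_ineq4[of z1 z2] by linarith
      then have "norm z \<le> (1 / t) * (2 * real n)"
        using t by (simp add: z_def divide_right_mono)
      also have "\<dots> = M * norm b"
        using b0 by (simp add: M_def t_def)
      finally show ?thesis .
    qed
    moreover have "norm (b - f z) \<le> norm b / 2"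
    proof -
      have "f z = (1 / t) *\<^sub>R (a1 - a2)"
        unfolding z_def using S z f
        by (simp add: linear_map_on_scale[OF f] linear_map_on_diff[OF f] subspace_diff)
      then have "b - f z = (1 / t) *\<^sub>R ((b0 + t *\<^sub>R b - a1) - (b0 - a2))"
        using t by (simp add: algebra_simps)
      moreover have "norm ((b0 + t *\<^sub>R b - a1) - (b0 - a2)) \<le> \<rho> / 4"
        using a norm_triangle_ineq4[of "b0 + t *\<^sub>R b - a1" "b0 - a2"]
        by (simp add: dist_norm norm_minus_commute)
      ultimately have "norm (b - f z) \<le> (1 / t) * (\<rho> / 4)"
        using t mult_left_mono[of _ "\<rho> / 4" "1 / t"] by (simp only: norm_scaleR) simp
      also have "\<dots> = norm b / 2"
        using b0 by (simp add: t_def)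
      finally show ?thesis .
    qed
    ultimately show ?thesis
      by blast
  qed
  then obtain g where g: "\<And>b. b \<in> f ` S \<Longrightarrow> g b \<in> S"
      "\<And>b. b \<in> f ` S \<Longrightarrow> norm (g b) \<le> M * norm b"
      "\<And>b. b \<in> f ` S \<Longrightarrow> norm (b - f (g b)) \<le> norm b / 2"
    by metis
  have "\<exists>z\<in>S. f z = b \<and> norm z \<le> (2 * M) * norm b" if b: "b \<in> f ` S" for b
  proof -
    \<comment> \<open>\<open>r n\<close> is the residual after \<open>n\<close> corrections; the
      factor 2 in the bound is the sum of the geometric series.\<close>
    define r where "r = rec_nat b (\<lambda>_ x. x - f (g x))"
    have r: "r 0 = b" "\<And>n. r (Suc n) = r n - f (g (r n))"
      by (simp_all add: r_def)
    have rB: "r n \<in> f ` S" for n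
      by (induction n) (auto simp: r b g intro!: subspace_diff[OF sub])
    have rn: "norm (r n) \<le> norm b * (1/2) ^ n" for n
    proof (induction n)
      case (Suc n)
      then show ?case
        using g(3)[OF rB[of n]] by (simp add: r)
    qed (simp add: r)
    define z where "z n = g (r n)" for n
    have zS: "z n \<in> S" for n
      using g rB by (simp add: z_def)
    have zn: "norm (z n) \<le> (M * norm b) * (1/2) ^ n" for n
      using g(2)[OF rB[of n]] mult_left_mono[OF rn[of n] \<open>0 \<le> M\<close>] by (simp add: z_def)
    define s where "s n = (\<Sum>i<n. z i)" for n
    have sS: "s n \<in> S" for n
      unfolding s_def by (intro subspace_sum S zS)
    have "Cauchy s"
      unfolding s_def by (rule Cauchy_if_geometric_increments[OF zn])
    then obtain l where l: "s \<longlonglongrightarrow> l"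
      using sS S unfolding complete_def by (meson subsetD)
    have fs: "f (s n) = b - r n" for n
    proof -
      have "f (s n) = (\<Sum>i<n. f (z i))"
        unfolding s_def by (rule linear_map_on_sum[OF f S(1) zS])
      also have "\<dots> = b - r n"
        by (induction n) (simp_all add: r z_def)
      finally show ?thesis .
    qed
    have "(\<lambda>n. norm b * (1/2) ^ n) \<longlonglongrightarrow> norm b * 0"
      by (rule tendsto_mult_left, rule LIMSEQ_realpow_zero) auto
    then have "r \<longlonglongrightarrow> 0"
      using rn by (intro Lim_null_comparison[of r]) auto
    then have "(\<lambda>n. b - r n) \<longlonglongrightarrow> b - 0"
      by (rule tendsto_diff[OF tendsto_const])
    then have "(\<lambda>n. (s n, f (s n))) \<longlonglongrightarrow> (l, b)"
      by (intro tendsto_Pair l) (simp add: fs)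
    moreover have "(s n, f (s n)) \<in> {(v, f v) | v. v \<in> S}" for n
      using sS by blast
    ultimately have "(l, b) \<in> {(v, f v) | v. v \<in> S}"
      using cl by (meson closed_sequentially)
    then have "l \<in> S" "f l = b"
      by auto
    moreover have "norm l \<le> (2 * M) * norm b"
    proof (rule LIMSEQ_le_const2[OF tendsto_norm[OF l]])
      have "norm (s n) \<le> (2 * M) * norm b" for n
      proof -
        have "norm (s n) \<le> (\<Sum>i<n. (M * norm b) * (1/2) ^ i)"
          unfolding s_def by (intro sum_norm_le zn)
        also have "\<dots> = (M * norm b) * (\<Sum>i<n. (1/2) ^ i)"
          by (simp add: sum_distrib_left)
        also have "\<dots> \<le> (M * norm b) * 2"
          using \<open>0 \<le> M\<close> by (intro mult_left_mono) (simp_all add: sum_gp_strict)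
        finally show ?thesis
          by (simp add: mult_ac)
      qed
      then show "\<exists>N. \<forall>n\<ge>N. norm (s n) \<le> (2 * M) * norm b"
        by blast
    qed
    ultimately show ?thesis
      by blast
  qed
  then show ?thesis
    by blast
qed

section \<open>Hilbert complexes and cochain projections\<close>

lemma norm_V_eq: "norm_V d k v = sqrt ((norm v)\<^sup>2 + (norm (d k v))\<^sup>2)"
  by (simp add: norm_V_def inner_V_def power2_norm_eq_inner)

lemma norm_V_nonneg: "0 \<le> norm_V d k v"
  by (simp add: norm_V_eq)

lemma norm_le_norm_V: "norm v \<le> norm_V d k v"
  unfolding norm_V_eq by (rule real_sqrt_sum_squares_ge1)

lemma norm_d_le_norm_V: "norm (d k v) \<le> norm_V d k v"
  unfolding norm_V_eq by (rule real_sqrt_sum_squares_ge2)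

lemma norm_V_le_norm_add: "norm_V d k v \<le> norm v + norm (d k v)"
  unfolding norm_V_eq by (rule sqrt_sum_squares_le_sum) auto

section \<open>Boundaries, cycles and the Hodge decomposition of the full complex\<close>

context hilbert_complex
begin

lemmas d_diff = linear_map_on_diff[OF linear_d subspace_V]

lemma boundaries_subset_cycles: "boundaries d V k \<subseteq> cycles d V k"
  using range_subset_domain[of "k - 1"] d_d_zero[of _ "k - 1"]
  by (auto simp: boundaries_def cycles_def)

lemma subspace_boundaries: "subspace (boundaries d V k)"
  unfolding boundaries_def by (rule subspace_image_linear_map_on[OF linear_d subspace_V])

end

context closed_hilbert_complex
begin

lemma complete_range: "complete (d k ` V k)"
proof -
  have "d k ` V k \<subseteq> W (k + 1)"
    using range_subset_domain domain_subset by blast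
  then have "d k ` V k = W (k + 1) \<inter> d k ` V k"
    by blast
  then show ?thesis
    using complete_Int_closed[OF complete_W[of "k + 1"] closed_range[of k]] by simp
qed

text \<open>The Poincare inequality, stated through a bounded choice of preimages instead of the
  orthogonal complement of the kernel.\<close>

lemma bounded_lifting:
  "\<exists>K\<ge>0. \<forall>b\<in>d k ` V k. \<exists>z\<in>V k. d k z = b \<and> norm_V d k z \<le> K * norm b"
proof -
  obtain K where K: "\<And>b. b \<in> d k ` V k \<Longrightarrow> \<exists>z\<in>V k. d k z = b \<and> norm z \<le> K * norm b"
    using bounded_right_inverse[OF subspace_V domain_subset complete_W linear_d closed_graph
        complete_range] by metis
  \<comment> \<open>The absolute value makes the constant nonnegative, and the added 1 pays for
    \<open>norm (d k z) = norm b\<close> in the graph norm.\<close>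
  have "\<exists>z\<in>V k. d k z = b \<and> norm_V d k z \<le> (\<bar>K\<bar> + 1) * norm b" if "b \<in> d k ` V k" for b
  proof -
    obtain z where z: "z \<in> V k" "d k z = b" "norm z \<le> K * norm b"
      using K \<open>b \<in> d k ` V k\<close> by blast
    have "K * norm b \<le> \<bar>K\<bar> * norm b"
      by (simp add: mult_right_mono)
    then have "norm_V d k z \<le> (\<bar>K\<bar> + 1) * norm b"
      using norm_V_le_norm_add[of d k z] z by (simp add: distrib_right)
    then show ?thesis
      using z by blast
  qed
  moreover have "0 \<le> \<bar>K\<bar> + 1"
    by simp
  ultimately show ?thesis
    by blast
qed

text \<open>Project onto the boundaries, which are complete; the remainder is still a cycle because
  boundaries are cycles.\<close>

lemma hodge_decomposition:
  assumes "z \<in> cycles d V k"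
  shows "\<exists>b\<in>boundaries d V k. z - b \<in> harmonics d V k"
proof -
  obtain b where b: "b \<in> boundaries d V k" "z - b \<in> (boundaries d V k)\<^sup>\<bottom>"
    using exists_orth_proj_complete[OF subspace_boundaries] complete_range[of "k - 1"]
    unfolding boundaries_def by metis
  then have "b \<in> cycles d V k"
    using boundaries_subset_cycles by blast
  then have "z - b \<in> cycles d V k"
    using assms by (simp add: cycles_def d_diff subspace_diff[OF subspace_V])
  then show ?thesis
    using b by (auto simp: harmonics_def)
qed

lemma orth_proj_boundaries:
  shows "orth_proj (boundaries d V k) x \<in> boundaries d V k"
    and "x - orth_proj (boundaries d V k) x \<in> (boundaries d V k)\<^sup>\<bottom>"
proof -
  obtain y where "y \<in> boundaries d V k" "x - y \<in> (boundaries d V k)\<^sup>\<bottom>"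
    using exists_orth_proj_complete[OF subspace_boundaries] complete_range[of "k - 1"]
    unfolding boundaries_def by metis
  then show "orth_proj (boundaries d V k) x \<in> boundaries d V k"
      "x - orth_proj (boundaries d V k) x \<in> (boundaries d V k)\<^sup>\<bottom>"
    using orth_proj_eqI[OF subspace_boundaries] by metis+
qed

end

section \<open>The discrete Hodge decomposition\<close>

context fin_dim_subcomplex
begin

lemmas Vh_mem_V = subsetD[OF Vh_subset]

lemma boundaries_Vh_subset_cycles: "boundaries d Vh k \<subseteq> cycles d Vh k"
  using d_Vh_subset[of "k - 1"] d_d_zero[of _ "k - 1"] Vh_subset[of "k - 1"]
  by (auto simp: boundaries_def cycles_def)

lemma boundaries_Vh_subset: "boundaries d Vh k \<subseteq> boundaries d V k"
  using Vh_subset by (auto simp: boundaries_def)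

lemma subspace_boundaries_Vh: "subspace (boundaries d Vh k)"
  unfolding boundaries_def
  by (rule subspace_image_linear_map_on[OF linear_map_on_subset[OF linear_d Vh_subset] subspace_Vh])

lemma harmonics_Vh_subset_cycles: "harmonics d Vh k \<subseteq> cycles d V k"
  using Vh_subset by (auto simp: harmonics_def cycles_def)

lemma harmonics_Vh_diff:
  assumes "x \<in> harmonics d Vh k" "y \<in> harmonics d Vh k"
  shows "x - y \<in> harmonics d Vh k"
proof -
  have "x - y \<in> (boundaries d Vh k)\<^sup>\<bottom>"
    using assms by (intro subspace_diff[OF subspace_orthogonal_comp]) (auto simp: harmonics_def)
  then show ?thesis
    using assms
    by (simp add: harmonics_def cycles_def d_diff Vh_mem_V subspace_diff[OF subspace_Vh])
qed

lemma discrete_hodge_decomposition: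
  assumes "z \<in> cycles d Vh k"
  shows "\<exists>b\<in>boundaries d Vh k. z - b \<in> harmonics d Vh k"
proof -
  obtain s where s: "finite s" "Vh k = span s"
    using finite_dim_Vh by blast
  have "boundaries d Vh k \<subseteq> span s"
    using boundaries_Vh_subset_cycles s by (auto simp: cycles_def)
  then obtain b where b: "b \<in> boundaries d Vh k" "z - b \<in> (boundaries d Vh k)\<^sup>\<bottom>"
    using exists_orth_proj_finite_dim[OF subspace_boundaries_Vh s(1)] by metis
  then have "b \<in> cycles d Vh k"
    using boundaries_Vh_subset_cycles by blast
  then have "z - b \<in> cycles d Vh k"
    using assms by (simp add: cycles_def d_diff Vh_mem_V subspace_diff[OF subspace_Vh])
  then show ?thesis
    using b by (auto simp: harmonics_def)
qed

end

section \<open>Consequences of a bounded commuting projection\<close>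

context cochain_projection
begin

lemma proj_mem: "v \<in> V k \<Longrightarrow> \<pi> k v \<in> Vh k"
  using proj_into by blast

lemma proj_boundaries:
  assumes "b \<in> boundaries d V k"
  shows "\<pi> k b \<in> boundaries d Vh k"
proof -
  obtain w where w: "w \<in> V (k - 1)" "b = d (k - 1) w"
    using assms by (auto simp: boundaries_def)
  then have "\<pi> k b = d (k - 1) (\<pi> (k - 1) w)"
    using proj_commutes[of w "k - 1"] by simp
  then show ?thesis
    using proj_mem[OF w(1)] by (simp add: boundaries_def)
qed

text \<open>As \<open>\<pi> k\<close> fixes \<open>w\<close>, the projection errors of
  \<open>v\<close> and \<open>v - w\<close> agree, so boundedness gives quasi-best
  approximation.\<close>

lemma proj_error:
  assumes c: "\<And>v. v \<in> V k \<Longrightarrow> norm_V d k (\<pi> k v) \<le> c * norm_V d k v"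
    and v: "v \<in> V k" and w: "w \<in> Vh k"
  shows "norm (v - \<pi> k v) \<le> (1 + c) * norm_V d k (v - w)"
proof -
  have "v - \<pi> k v = (v - w) - \<pi> k (v - w)"
    using linear_map_on_diff[OF linear_proj subspace_V v Vh_mem_V[OF w]] proj_id[OF w] by simp
  then have "norm (v - \<pi> k v) \<le> norm (v - w) + norm (\<pi> k (v - w))"
    by (metis norm_triangle_ineq4)
  also have "\<dots> \<le> norm_V d k (v - w) + norm_V d k (\<pi> k (v - w))"
    by (intro add_mono norm_le_norm_V)
  also have "\<dots> \<le> norm_V d k (v - w) + c * norm_V d k (v - w)"
    using c v w by (simp add: subspace_diff[OF subspace_V] Vh_mem_V)
  finally show ?thesis
    by (simp add: distrib_right)
qed

text \<open>
  The projection carries any bounded preimage of an element of the range over \<open>Vh\<close> to a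
  discrete preimage, so the constant of the discrete Poincare inequality is independent of \<open>Vh\<close>.
\<close>

lemma discrete_lifting:
  assumes "0 \<le> c" "\<And>v. v \<in> V k \<Longrightarrow> norm_V d k (\<pi> k v) \<le> c * norm_V d k v"
    and K: "\<And>b. b \<in> d k ` V k \<Longrightarrow> \<exists>z\<in>V k. d k z = b \<and> norm_V d k z \<le> K * norm b"
    and v: "v \<in> Vh k"
  shows "\<exists>w\<in>Vh k. d k w = d k v \<and> norm w \<le> c * K * norm (d k v)"
proof -
  obtain z where z: "z \<in> V k" "d k z = d k v" "norm_V d k z \<le> K * norm (d k v)"
    using K Vh_mem_V[OF v] by blast
  have "d k v \<in> Vh (k + 1)"
    using d_Vh_subset v by blast
  then have "d k (\<pi> k z) = d k v"
    using proj_commutes[OF z(1)] proj_id z(2) by simp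
  moreover have "norm (\<pi> k z) \<le> c * (K * norm (d k v))"
    using norm_le_norm_V[of "\<pi> k z" d k] assms(2)[OF z(1)] mult_left_mono[OF z(3) \<open>0 \<le> c\<close>]
    by linarith
  ultimately show ?thesis
    using proj_mem[OF z(1)] by (auto simp: mult.assoc)
qed

end

text \<open>One member of the family, together with the two numbers that enter the final constant.
  Choosing \<open>c\<close> and \<open>L\<close> independently of the member makes every bound in
  terms of them uniform. Liftings are required in degree \<open>k - 1\<close> for the boundary part
  of the error and in degree \<open>k\<close> for its differential.\<close>

locale stable_cochain_projection =
  closed_hilbert_complex W V d + cochain_projection W V d Vh \<pi>
  for W V :: "int \<Rightarrow> 'a::real_inner set" and d :: "int \<Rightarrow> 'a \<Rightarrow> 'a"
    and Vh :: "int \<Rightarrow> 'a set" and \<pi> :: "int \<Rightarrow> 'a \<Rightarrow> 'a" +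
  fixes k :: int and c L :: real
  assumes c_nonneg: "0 \<le> c" and L_nonneg: "0 \<le> L"
    and proj_bounded: "v \<in> V k \<Longrightarrow> norm_V d k (\<pi> k v) \<le> c * norm_V d k v"
    and lift: "j \<in> {k - 1, k} \<Longrightarrow> v \<in> Vh j \<Longrightarrow> \<exists>w\<in>Vh j. d j w = d j v \<and> norm w \<le> L * norm (d j v)"
begin

abbreviation "gap \<equiv> harmonic_gap V d \<pi> k"

lemma proj_error_k: "v \<in> V k \<Longrightarrow> w \<in> Vh k \<Longrightarrow> norm (v - \<pi> k v) \<le> (1 + c) * norm_V d k (v - w)"
  by (rule proj_error[OF proj_bounded])

lemma bdd_above_harmonic_gap:
  "bdd_above ((\<lambda>r. norm (r - \<pi> k r)) ` {r \<in> harmonics d V k. norm r = 1})"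
proof (rule bdd_aboveI2)
  fix r assume r: "r \<in> {r \<in> harmonics d V k. norm r = 1}"
  then have "r \<in> V k" "norm_V d k (r - 0) = 1"
    by (auto simp: harmonics_def cycles_def norm_V_eq)
  then show "norm (r - \<pi> k r) \<le> 1 + c"
    using proj_error_k[of r 0] subspace_0[OF subspace_Vh] by simp
qed

lemma gap_nonneg: "0 \<le> gap"
proof (cases "{r \<in> harmonics d V k. norm r = 1} = {}")
  case False
  then obtain r where "r \<in> {r \<in> harmonics d V k. norm r = 1}"
    by blast
  from cSUP_upper[OF this bdd_above_harmonic_gap] show ?thesis
    using False norm_ge_zero[of "r - \<pi> k r"] by (simp only: harmonic_gap_def Let_def if_False)
qed (simp add: harmonic_gap_def)

text \<open>Homogeneity extends the supremum over unit vectors to all harmonic \<open>r\<close>; the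
  case \<open>r = 0\<close> also covers an empty set of unit vectors.\<close>

lemma harmonic_proj_error:
  assumes r: "r \<in> harmonics d V k"
  shows "norm (r - \<pi> k r) \<le> gap * norm r"
proof (cases "r = 0")
  case True
  then show ?thesis
    using linear_map_on_zero[OF linear_proj subspace_V] by simp
next
  case False
  define s where "s = (1 / norm r) *\<^sub>R r"
  have rV: "r \<in> V k"
    using r by (simp add: harmonics_def cycles_def)
  have "s \<in> (boundaries d V k)\<^sup>\<bottom>"
    unfolding s_def using r
    by (intro subspace_scale[OF subspace_orthogonal_comp]) (simp add: harmonics_def)
  then have "s \<in> harmonics d V k"
    using r by (simp add: s_def harmonics_def cycles_def linear_map_on_scale[OF linear_d]
        subspace_scale[OF subspace_V])
  then have s: "s \<in> {r \<in> harmonics d V k. norm r = 1}"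
    using False by (simp add: s_def)
  then have ne: "{r \<in> harmonics d V k. norm r = 1} \<noteq> {}"
    by blast
  from cSUP_upper[OF s bdd_above_harmonic_gap] have "norm (s - \<pi> k s) \<le> gap"
    using ne by (simp only: harmonic_gap_def Let_def if_False)
  moreover have "s - \<pi> k s = (1 / norm r) *\<^sub>R (r - \<pi> k r)"
    using linear_map_on_scale[OF linear_proj rV] by (simp add: s_def scaleR_diff_right)
  ultimately have "norm (r - \<pi> k r) / norm r \<le> gap"
    by simp
  then show ?thesis
    using False by (simp add: pos_divide_le_eq)
qed

text \<open>Both \<open>q\<close> and \<open>q - b\<close> are orthogonal to the discrete boundary
  \<open>\<pi> k b\<close>, hence so is \<open>b\<close>, and \<open>b\<close> is no longer than
  \<open>b - \<pi> k b\<close>. Because \<open>\<pi> k\<close> fixes \<open>q\<close>, this is up to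
  sign the projection error of the harmonic \<open>q - b\<close>.\<close>

lemma discrete_harmonic_boundary_part:
  assumes q: "q \<in> harmonics d Vh k" and b: "b \<in> boundaries d V k" and r: "q - b \<in> harmonics d V k"
  shows "norm b \<le> gap * norm q"
proof -
  have \<pi>b: "\<pi> k b \<in> boundaries d Vh k"
    by (rule proj_boundaries[OF b])
  then have "q \<bullet> \<pi> k b = 0" "(q - b) \<bullet> \<pi> k b = 0"
    using q r boundaries_Vh_subset by (auto simp: harmonics_def intro: orthogonal_compD)
  then have "b \<bullet> \<pi> k b = 0"
    by (simp add: inner_diff_left)
  then have "norm b \<le> norm (b - \<pi> k b)"
    by (rule norm_diff_le_if_orthogonal)
  also have "\<dots> = norm ((q - b) - \<pi> k (q - b))"
  proof -
    have "q \<in> Vh k" "b \<in> V k"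
      using q b boundaries_subset_cycles by (auto simp: harmonics_def cycles_def)
    then have "\<pi> k (q - b) = q - \<pi> k b"
      using linear_map_on_diff[OF linear_proj subspace_V] proj_id Vh_mem_V by metis
    then show ?thesis
      by (simp add: norm_minus_commute)
  qed
  also have "\<dots> \<le> gap * norm (q - b)"
    by (rule harmonic_proj_error[OF r])
  also have "\<dots> \<le> gap * norm q"
  proof (intro mult_left_mono gap_nonneg)
    have "(q - b) \<bullet> (- b) = 0"
      using r b by (auto simp: harmonics_def dest: orthogonal_compD)
    from norm_diff_le_if_orthogonal[OF this] show "norm (q - b) \<le> norm q"
      by simp
  qed
  finally show ?thesis .
qed

text \<open>Discrete harmonics need not be harmonic, so \<open>u\<close> need not be orthogonal to
  them. The defect is a product of two small factors: the projection error of the boundary part of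
  \<open>u\<close> and the boundary part of \<open>q\<close>.\<close>

lemma inner_discrete_harmonic_le:
  assumes u: "\<And>r. r \<in> harmonics d V k \<Longrightarrow> u \<bullet> r = 0"
    and q: "q \<in> harmonics d Vh k" and v: "v \<in> Vh k"
  shows "\<bar>u \<bullet> q\<bar> \<le> norm q * ((1 + c) * (gap * norm_V d k (orth_proj (boundaries d V k) u - v)))"
proof -
  define y where "y = orth_proj (boundaries d V k) u"
  have y: "y \<in> boundaries d V k" "u - y \<in> (boundaries d V k)\<^sup>\<bottom>"
    unfolding y_def by (rule orth_proj_boundaries)+
  obtain b where b: "b \<in> boundaries d V k" "q - b \<in> harmonics d V k"
    using hodge_decomposition harmonics_Vh_subset_cycles q by blast
  have \<pi>y: "\<pi> k y \<in> boundaries d Vh k"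
    by (rule proj_boundaries[OF y(1)])
  \<comment> \<open>The first two identities replace \<open>u \<bullet> q\<close> by
    \<open>y \<bullet> b\<close>; the last two make \<open>b\<close> orthogonal to
    \<open>\<pi> k y\<close>, which may then be subtracted.\<close>
  have "u \<bullet> (q - b) = 0" "(u - y) \<bullet> b = 0" "(q - b) \<bullet> y = 0" "q \<bullet> \<pi> k y = 0" "(q - b) \<bullet> \<pi> k y = 0"
    using u b y q \<pi>y boundaries_Vh_subset by (auto simp: harmonics_def intro: orthogonal_compD)
  then have "u \<bullet> q = (y - \<pi> k y) \<bullet> b"
    by (simp add: inner_diff inner_commute)
  then have "\<bar>u \<bullet> q\<bar> \<le> norm (y - \<pi> k y) * norm b"
    by (simp add: Cauchy_Schwarz_ineq2)
  also have "\<dots> \<le> ((1 + c) * norm_V d k (y - v)) * (gap * norm q)"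
  proof (intro mult_mono discrete_harmonic_boundary_part[OF q b])
    show "norm (y - \<pi> k y) \<le> (1 + c) * norm_V d k (y - v)"
      using y(1) v boundaries_subset_cycles by (intro proj_error_k) (auto simp: cycles_def)
    show "0 \<le> (1 + c) * norm_V d k (y - v)"
      using c_nonneg norm_V_nonneg[of d k "y - v"] by simp
  qed simp
  finally show ?thesis
    by (simp add: y_def mult_ac)
qed

end

section \<open>Error estimates\<close>

text \<open>Allows the estimate to be proved for arbitrary competitors, with the infima inserted
  afterwards and no question of their attainment.\<close>

lemma INF_approx:
  fixes g :: "'b \<Rightarrow> real"
  assumes "A \<noteq> {}" "\<And>x. x \<in> A \<Longrightarrow> 0 \<le> g x" "0 < e"
  shows "\<exists>x\<in>A. g x < (INF x\<in>A. g x) + e"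
proof -
  have "bdd_below (g ` A)"
    using assms(2) by (intro bdd_belowI2[of _ 0])
  then show ?thesis
    using cINF_less_iff[OF assms(1), of g "(INF x\<in>A. g x) + e"] \<open>0 < e\<close> by simp
qed

text \<open>An explicit function of \<open>c\<close> and \<open>L\<close>, so independence of the
  subcomplex and of \<open>f\<close> is visible. \<open>Cp\<close> belongs to the error of
  \<open>p\<close>; \<open>Cd\<close>, \<open>Cu\<close> and \<open>Cs\<close> belong to the
  discrete parts of the errors of \<open>d u\<close>, \<open>u\<close> and
  \<open>\<sigma>\<close>.\<close>

definition stability_constant :: "real \<Rightarrow> real \<Rightarrow> real" where
  "stability_constant c L =
     (let Cp = 1 + 2 * (1 + c);
          Cd = 1 + L * (1 + Cp);
          Cu = 3 + c + 3 * L * Cd + L;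
          Cs = 3 + 4 * Cu
      in 2 + Cs + (2 + Cu * (1 + Cs) + Cd) + Cp)"

lemma stability_constant_nonneg: "0 \<le> c \<Longrightarrow> 0 \<le> L \<Longrightarrow> 0 \<le> stability_constant c L"
  by (simp add: stability_constant_def Let_def)

section \<open>Quasi-optimality for a single subcomplex\<close>

context stable_cochain_projection
begin

lemma error_estimate:
  assumes sol: "mixed_solution d V k f \<sigma> u p"
    and solh: "mixed_solution d Vh k f \<sigma>h uh ph"
    and mem: "\<tau> \<in> Vh (k - 1)" "v \<in> Vh k" "q \<in> Vh k" "w \<in> Vh k"
  shows "norm_V d (k - 1) (\<sigma> - \<sigma>h) + norm_V d k (u - uh) + norm (p - ph)
    \<le> stability_constant c L *
      (norm_V d (k - 1) (\<sigma> - \<tau>) + norm_V d k (u - v) + norm_V d k (p - q)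
       + gap * norm_V d k (orth_proj (boundaries d V k) u - w))"
proof -
  define Es where "Es = norm_V d (k - 1) (\<sigma> - \<tau>)"
  define Eu where "Eu = norm_V d k (u - v)"
  define Ep where "Ep = norm_V d k (p - q)"
  define Eb where "Eb = gap * norm_V d k (orth_proj (boundaries d V k) u - w)"
  define X where "X = Es + Eu + Ep + Eb"
  have nonneg: "0 \<le> Es" "0 \<le> Eu" "0 \<le> Ep" "0 \<le> Eb"
    using gap_nonneg by (simp_all add: Es_def Eu_def Ep_def Eb_def norm_V_nonneg)
  then have le_X: "Es \<le> X" "Eu \<le> X" "Ep \<le> X" "Eb \<le> X" and X: "0 \<le> X"
    by (simp_all add: X_def)

  have V: "\<sigma> \<in> V (k - 1)" "u \<in> V k" "p \<in> harmonics d V k"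
    and 1: "\<And>\<tau>. \<tau> \<in> V (k - 1) \<Longrightarrow> \<sigma> \<bullet> \<tau> = d (k - 1) \<tau> \<bullet> u"
    and 2: "\<And>v. v \<in> V k \<Longrightarrow> d (k - 1) \<sigma> \<bullet> v + d k u \<bullet> d k v + v \<bullet> p = f \<bullet> v"
    and 3: "\<And>q. q \<in> harmonics d V k \<Longrightarrow> u \<bullet> q = 0"
    using sol by (simp_all add: mixed_solution_def)
  \<comment> \<open>From here \<open>1\<close> and \<open>2\<close> denote the error equations: both
    systems are tested with the same discrete functions and subtracted, so \<open>f\<close>
    cancels.\<close>
  have Vh: "\<sigma>h \<in> Vh (k - 1)" "uh \<in> Vh k" "ph \<in> harmonics d Vh k"
    and 1: "\<And>\<tau>. \<tau> \<in> Vh (k - 1) \<Longrightarrow> (\<sigma> - \<sigma>h) \<bullet> \<tau> = d (k - 1) \<tau> \<bullet> (u - uh)"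
    and 2: "\<And>v. v \<in> Vh k \<Longrightarrow>
      (d (k - 1) \<sigma> - d (k - 1) \<sigma>h) \<bullet> v + (d k u - d k uh) \<bullet> d k v + v \<bullet> (p - ph) = 0"
    and 4: "\<And>q. q \<in> harmonics d Vh k \<Longrightarrow> uh \<bullet> q = 0"
    using solh 1 2 Vh_mem_V by (simp_all add: mixed_solution_def algebra_simps)
  note VhV = Vh(1,2)[THEN Vh_mem_V] mem[THEN Vh_mem_V]
  have pV: "p \<in> V k"
    using V(3) by (simp add: harmonics_def cycles_def)
  have d_boundary: "d (k - 1) t \<in> boundaries d Vh k" if "t \<in> Vh (k - 1)" for t
    using that by (simp add: boundaries_def)
  have cycle: "z \<in> Vh k" "d k z = 0" if "z \<in> boundaries d Vh k" for z
    using that boundaries_Vh_subset_cycles by (auto simp: cycles_def)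
  have harm: "z \<in> Vh k" "d k z = 0" "\<And>y. y \<in> boundaries d Vh k \<Longrightarrow> z \<bullet> y = 0"
    if "z \<in> harmonics d Vh k" for z
    using that by (auto simp: harmonics_def cycles_def dest: orthogonal_compD)

  define s where "s = d (k - 1) \<sigma> - d (k - 1) \<sigma>h"
  \<comment> \<open>A discrete boundary has zero differential and is orthogonal to both
    \<open>p\<close> and \<open>ph\<close>, so only the first term of the error equation
    survives.\<close>
  have s_orth: "s \<bullet> d (k - 1) t = 0" if t: "t \<in> Vh (k - 1)" for t
  proof -
    note b = d_boundary[OF t]
    have "d (k - 1) t \<bullet> p = 0" "d (k - 1) t \<bullet> ph = 0"
      using V(3) harm(3)[OF Vh(3) b] b boundaries_Vh_subset
      by (auto simp: harmonics_def inner_commute dest: orthogonal_compD)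
    then show ?thesis
      using 2[OF cycle(1)[OF b]] cycle(2)[OF b] by (simp add: s_def inner_diff_right)
  qed
  have "norm s \<le> norm (s - d (k - 1) (\<tau> - \<sigma>h))"
    using mem Vh by (intro norm_diff_le_if_orthogonal s_orth subspace_diff[OF subspace_Vh])
  also have "s - d (k - 1) (\<tau> - \<sigma>h) = d (k - 1) (\<sigma> - \<tau>)"
    using V VhV by (simp add: s_def d_diff Vh_mem_V Vh(1))
  also have "norm \<dots> \<le> Es"
    unfolding Es_def by (rule norm_d_le_norm_V)
  finally have s_le: "norm s \<le> Es" .

  have p_le: "norm (p - ph) \<le> Es + 2 * ((1 + c) * Ep)"
  proof -
    have "\<pi> k p \<in> cycles d Vh k"
      using proj_mem[OF pV] proj_commutes[OF pV] V(3)
        linear_map_on_zero[OF linear_proj subspace_V]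
      by (simp add: cycles_def harmonics_def)
    then obtain b where b: "b \<in> boundaries d Vh k" "\<pi> k p - b \<in> harmonics d Vh k"
      using discrete_hodge_decomposition by blast
    \<comment> \<open>The discrete harmonic part of \<open>\<pi> k p\<close>. Since \<open>p\<close>
      is orthogonal to \<open>b\<close>, passing from \<open>\<pi> k p\<close> to \<open>q0\<close>
      does not increase the distance from \<open>p\<close>.\<close>
    define q0 where "q0 = \<pi> k p - b"
    have \<epsilon>: "norm (p - \<pi> k p) \<le> (1 + c) * Ep"
      unfolding Ep_def by (rule proj_error_k[OF pV mem(3)])
    have "p \<bullet> b = 0" "q0 \<bullet> b = 0"
      using V(3) b boundaries_Vh_subset harm(3)[OF b(2) b(1)]
      by (auto simp: q0_def harmonics_def dest: orthogonal_compD)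
    then have "(p - q0) \<bullet> b = 0"
      by (simp add: inner_diff_left)
    from norm_diff_le_if_orthogonal[OF this] have "norm (p - q0) \<le> norm (p - \<pi> k p)"
      by (simp add: q0_def)
    moreover have "norm (q0 - ph) \<le> norm s + norm (p - q0)"
    proof (rule norm_le_if_inner_le)
      have r: "q0 - ph \<in> harmonics d Vh k"
        unfolding q0_def by (rule harmonics_Vh_diff[OF b(2) Vh(3)])
      have "(q0 - ph) \<bullet> (p - ph) = - (s \<bullet> (q0 - ph))"
        using 2[OF harm(1)[OF r]] harm(2)[OF r] by (simp add: s_def)
      then have "(q0 - ph) \<bullet> (q0 - ph) = - (s \<bullet> (q0 - ph)) - (p - q0) \<bullet> (q0 - ph)"
        by (simp add: algebra_simps inner_commute)
      also have "\<dots> \<le> norm s * norm (q0 - ph) + norm (p - q0) * norm (q0 - ph)"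
        using Cauchy_Schwarz_ineq2[of s "q0 - ph"] Cauchy_Schwarz_ineq2[of "p - q0" "q0 - ph"]
        by linarith
      finally show "(q0 - ph) \<bullet> (q0 - ph) \<le> norm (q0 - ph) * (norm s + norm (p - q0))"
        by (simp add: algebra_simps)
    qed simp
    moreover have "norm (p - ph) \<le> norm (p - q0) + norm (q0 - ph)"
      using norm_triangle_ineq[of "p - q0" "q0 - ph"] by simp
    ultimately show ?thesis
      using \<epsilon> s_le by linarith
  qed

  \<comment> \<open>Discrete parts of the errors: \<open>u - uh = (u - v) - e\<close> and
    \<open>\<sigma> - \<sigma>h = (\<sigma> - \<tau>) - a\<close>.\<close>
  define e where "e = uh - v"
  define a where "a = \<sigma>h - \<tau>"
  have e: "e \<in> Vh k" and a: "a \<in> Vh (k - 1)"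
    using mem Vh by (simp_all add: e_def a_def subspace_diff[OF subspace_Vh])
  have de: "d k e = d k (u - v) - (d k u - d k uh)"
    using V VhV Vh by (simp add: e_def d_diff Vh_mem_V)
  \<comment> \<open>Testing with \<open>y\<close> in place of \<open>e\<close> leaves the term in
    \<open>d k e\<close> unchanged, while \<open>norm y\<close> is controlled by
    \<open>norm (d k e)\<close>.\<close>
  obtain y where y: "y \<in> Vh k" "d k y = d k e" "norm y \<le> L * norm (d k e)"
    using lift[of k e] e by auto
  have uv: "norm (u - v) \<le> Eu" "norm (d k (u - v)) \<le> Eu"
    unfolding Eu_def by (rule norm_le_norm_V norm_d_le_norm_V)+
  have st: "norm (\<sigma> - \<tau>) \<le> Es" "norm (d (k - 1) (\<sigma> - \<tau>)) \<le> Es"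
    unfolding Es_def by (rule norm_le_norm_V norm_d_le_norm_V)+

  have de_le: "norm (d k e) \<le> Eu + L * (Es + norm (p - ph))"
  proof (rule norm_le_if_inner_le)
    have "d k e \<bullet> d k e = (d k (u - v) - (d k u - d k uh)) \<bullet> d k e"
      by (simp only: de)
    also have "\<dots> = d k (u - v) \<bullet> d k e - (d k u - d k uh) \<bullet> d k y"
      by (simp only: inner_diff_left y(2))
    also have "\<dots> = d k (u - v) \<bullet> d k e + s \<bullet> y + y \<bullet> (p - ph)"
      using 2[OF y(1)] by (simp add: s_def)
    also have "\<dots> \<le> norm (d k (u - v)) * norm (d k e) + norm y * (norm s + norm (p - ph))"
      using norm_cauchy_schwarz[of "d k (u - v)" "d k e"] norm_cauchy_schwarz[of s y]
        norm_cauchy_schwarz[of y "p - ph"]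
      by (simp add: algebra_simps)
    also have "\<dots> \<le> Eu * norm (d k e) + (L * norm (d k e)) * (Es + norm (p - ph))"
      using uv y s_le L_nonneg nonneg by (intro add_mono mult_mono) auto
    finally show "d k e \<bullet> d k e \<le> norm (d k e) * (Eu + L * (Es + norm (p - ph)))"
      by (simp add: algebra_simps)
  qed (use nonneg L_nonneg in simp)

  \<comment> \<open>The splitting \<open>e = y + b + r\<close> into lifting, boundary and harmonic
    part. Each summand contributes one \<open>norm y\<close>, and the bound on \<open>b\<close>
    brings in the still unknown \<open>norm a\<close>.\<close>
  have e_le: "norm e \<le> 2 * Eu + (1 + c) * Eb + 3 * norm y + L * (Es + norm a)"
  proof -
    have "e - y \<in> cycles d Vh k"
      using e y by (simp add: cycles_def d_diff Vh_mem_V subspace_diff[OF subspace_Vh])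
    then obtain b where b: "b \<in> boundaries d Vh k" "e - y - b \<in> harmonics d Vh k"
      using discrete_hodge_decomposition by blast
    define r where "r = e - y - b"
    have r: "r \<in> harmonics d Vh k"
      using b by (simp add: r_def)
    have rb: "r \<bullet> b = 0"
      by (rule harm(3)[OF r b(1)])
    have "b \<in> d (k - 1) ` Vh (k - 1)"
      using b by (simp add: boundaries_def)
    then obtain t where t: "t \<in> Vh (k - 1)" "d (k - 1) t = b" "norm t \<le> L * norm b"
      using lift[of "k - 1"] by fastforce
    have "norm (\<sigma> - \<sigma>h) \<le> Es + norm a"
      using st norm_triangle_ineq4[of "\<sigma> - \<tau>" a] by (simp add: a_def)
    then have t_le: "norm t * norm (\<sigma> - \<sigma>h) \<le> (L * norm b) * (Es + norm a)"
      using t L_nonneg by (intro mult_mono) auto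
    have "norm b \<le> Eu + L * (Es + norm a) + norm y"
    \<comment> \<open>The first error equation, tested with the short preimage \<open>t\<close> of
      \<open>b\<close>, trades the error of \<open>u\<close> against that of
      \<open>\<sigma>\<close>.\<close>
    proof (rule norm_le_if_inner_le)
      have "b \<bullet> b = b \<bullet> e - b \<bullet> y"
        using rb by (simp add: r_def inner_diff_left inner_diff_right inner_commute)
      also have "b \<bullet> e = b \<bullet> (u - v) - (\<sigma> - \<sigma>h) \<bullet> t"
        using 1[OF t(1)] t(2) by (simp add: e_def inner_diff_right)
      finally have "b \<bullet> b \<le> norm b * norm (u - v) + norm t * norm (\<sigma> - \<sigma>h) + norm b * norm y"
        using norm_cauchy_schwarz[of b "u - v"] Cauchy_Schwarz_ineq2[of "\<sigma> - \<sigma>h" t]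
          Cauchy_Schwarz_ineq2[of b y]
        by (simp add: mult.commute)
      also have "\<dots> \<le> norm b * Eu + (L * norm b) * (Es + norm a) + norm b * norm y"
        using uv by (intro add_mono t_le mult_left_mono order_refl) auto
      finally show "b \<bullet> b \<le> norm b * (Eu + L * (Es + norm a) + norm y)"
        by (simp add: algebra_simps)
    qed (use nonneg L_nonneg in simp)
    moreover have "norm r \<le> Eu + (1 + c) * Eb + norm y"
    \<comment> \<open>Here \<open>uh\<close> is orthogonal to \<open>r\<close> exactly, so the only
      consistency error is \<open>u \<bullet> r\<close>, which carries the gap.\<close>
    proof (rule norm_le_if_inner_le)
      have "r \<bullet> r = r \<bullet> e - r \<bullet> y"
        using rb by (simp add: r_def inner_diff_left inner_diff_right inner_commute)
      also have "r \<bullet> e = r \<bullet> (u - v) - u \<bullet> r"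
        using 4[OF r] by (simp add: e_def inner_diff_right inner_commute)
      finally have "r \<bullet> r \<le> norm r * norm (u - v) + norm r * ((1 + c) * Eb) + norm r * norm y"
        using norm_cauchy_schwarz[of r "u - v"] inner_discrete_harmonic_le[OF 3 r mem(4)]
          Cauchy_Schwarz_ineq2[of r y]
        unfolding Eb_def by linarith
      also have "\<dots> \<le> norm r * Eu + norm r * ((1 + c) * Eb) + norm r * norm y"
        using mult_left_mono[OF uv(1), of "norm r"] by simp
      finally show "r \<bullet> r \<le> norm r * (Eu + (1 + c) * Eb + norm y)"
        by (simp add: algebra_simps)
    qed (use nonneg c_nonneg in simp)
    moreover have "norm e \<le> norm r + norm b + norm y"
      using norm_triangle_ineq[of "r + b" y] norm_triangle_ineq[of r b] by (simp add: r_def)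
    ultimately show ?thesis
      by linarith
  qed

  \<comment> \<open>The first error equation tested with \<open>a\<close>. The right side is linear
    in \<open>norm e\<close>, and \<open>e_le\<close> is linear in \<open>norm a\<close> with the
    small \<open>Es\<close> in front here, so the coupling can be resolved.\<close>
  have a_le: "norm a * norm a \<le> norm a * Es + 2 * Es * (Eu + norm e)"
  proof -
    have "d (k - 1) a = d (k - 1) (\<sigma> - \<tau>) - s"
      using V VhV by (simp add: a_def s_def d_diff)
    then have da: "norm (d (k - 1) a) \<le> 2 * Es"
      using norm_triangle_ineq4[of "d (k - 1) (\<sigma> - \<tau>)" s] st s_le by simp
    have "a \<bullet> a = (\<sigma> - \<tau>) \<bullet> a - d (k - 1) a \<bullet> (u - uh)"
      using 1[OF a] by (simp add: a_def inner_diff_left)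
    also have "\<dots> = (\<sigma> - \<tau>) \<bullet> a - d (k - 1) a \<bullet> ((u - v) - e)"
      by (simp add: e_def)
    also have "\<dots> \<le> norm (\<sigma> - \<tau>) * norm a + norm (d (k - 1) a) * norm ((u - v) - e)"
      using norm_cauchy_schwarz[of "\<sigma> - \<tau>" a] Cauchy_Schwarz_ineq2[of "d (k - 1) a" "(u - v) - e"]
      by linarith
    also have "\<dots> \<le> Es * norm a + (2 * Es) * (Eu + norm e)"
    proof (intro add_mono mult_mono)
      show "norm ((u - v) - e) \<le> Eu + norm e"
        using norm_triangle_ineq4[of "u - v" e] uv by linarith
    qed (use st da nonneg in auto)
    finally show ?thesis
      by (simp add: dot_square_norm power2_eq_square mult.commute)
  qed

  define Cp where "Cp = 1 + 2 * (1 + c)"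
  define Cd where "Cd = 1 + L * (1 + Cp)"
  define Cu where "Cu = 3 + c + 3 * L * Cd + L"
  define Cs where "Cs = 3 + 4 * Cu"
  have C: "0 \<le> Cp" "0 \<le> Cd" "0 \<le> Cu" "0 \<le> Cs"
    using c_nonneg L_nonneg by (simp_all add: Cp_def Cd_def Cu_def Cs_def)
  have p_X: "norm (p - ph) \<le> Cp * X"
  proof -
    have "(1 + c) * Ep \<le> (1 + c) * X"
      using le_X c_nonneg by (intro mult_left_mono) auto
    then show ?thesis
      using p_le le_X by (simp add: Cp_def algebra_simps)
  qed
  have de_X: "norm (d k e) \<le> Cd * X"
  proof -
    have "L * (Es + norm (p - ph)) \<le> L * (X + Cp * X)"
      using le_X p_X L_nonneg by (intro mult_left_mono) auto
    then show ?thesis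
      using de_le le_X by (simp add: Cd_def algebra_simps)
  qed
  have e_X: "norm e \<le> Cu * (X + norm a)"
  proof -
    have "norm y \<le> L * (Cd * X)"
      using y(3) mult_left_mono[OF de_X L_nonneg] by linarith
    moreover have "(1 + c) * Eb \<le> (1 + c) * X" "L * Es \<le> L * X"
      using le_X c_nonneg L_nonneg by (auto intro!: mult_left_mono)
    ultimately have "norm e \<le> 2 * X + (1 + c) * X + 3 * (L * (Cd * X)) + L * X + L * norm a"
      using e_le le_X by (simp add: distrib_left)
    also have "\<dots> = Cu * X + L * norm a"
      by (simp add: Cu_def algebra_simps)
    also have "\<dots> \<le> Cu * X + Cu * norm a"
      using mult_right_mono[of L Cu "norm a"] c_nonneg L_nonneg C by (simp add: Cu_def)
    finally show ?thesis
      by (simp add: distrib_left)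
  qed
  \<comment> \<open>If the bound failed, \<open>norm a\<close> would dominate \<open>X\<close>, and
    \<open>a_le\<close> with \<open>e_X\<close> would give
    \<open>norm a * norm a \<le> (3 + 4 * Cu) * X * norm a\<close>; this is where \<open>Cs\<close>
    comes from.\<close>
  have a_X: "norm a \<le> Cs * X"
  proof (rule ccontr)
    assume "\<not> norm a \<le> Cs * X"
    then have less: "Cs * X < norm a"
      by simp
    moreover have "X \<le> Cs * X"
      using X C mult_right_mono[of 1 Cs X] by (simp add: Cs_def)
    ultimately have "X \<le> norm a"
      by linarith
    have "0 < norm a"
      using less X C by (smt (verit) mult_nonneg_nonneg)
    have "Eu + norm e \<le> norm a + Cu * (norm a + norm a)"
      using e_X le_X \<open>X \<le> norm a\<close> mult_left_mono[of "X + norm a" "norm a + norm a" Cu] C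
      by linarith
    then have "2 * Es * (Eu + norm e) \<le> 2 * X * (norm a + Cu * (norm a + norm a))"
      using le_X nonneg X by (intro mult_mono) auto
    moreover have "norm a * Es \<le> norm a * X"
      using le_X by (simp add: mult_left_mono)
    ultimately have "norm a * norm a \<le> norm a * (Cs * X)"
      using a_le by (simp add: Cs_def algebra_simps)
    then show False
      using less \<open>0 < norm a\<close> by simp
  qed

  have "norm_V d (k - 1) (\<sigma> - \<sigma>h) \<le> norm (\<sigma> - \<sigma>h) + norm s"
    using norm_V_le_norm_add[of d "k - 1" "\<sigma> - \<sigma>h"] V VhV by (simp add: s_def d_diff)
  moreover have "norm (\<sigma> - \<sigma>h) \<le> Es + norm a"
    using st norm_triangle_ineq4[of "\<sigma> - \<tau>" a] by (simp add: a_def)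
  ultimately have \<sigma>_X: "norm_V d (k - 1) (\<sigma> - \<sigma>h) \<le> (2 + Cs) * X"
    using s_le a_X le_X by (simp add: algebra_simps)
  have "norm_V d k (u - uh) \<le> norm (u - uh) + norm (d k (u - uh))"
    by (rule norm_V_le_norm_add)
  also have "\<dots> = norm ((u - v) - e) + norm (d k (u - v) - d k e)"
    using V VhV by (simp add: e_def d_diff)
  also have "\<dots> \<le> (norm (u - v) + norm e) + (norm (d k (u - v)) + norm (d k e))"
    by (intro add_mono norm_triangle_ineq4)
  also have "\<dots> \<le> (X + Cu * (X + Cs * X)) + (X + Cd * X)"
  proof -
    have "norm e \<le> Cu * (X + Cs * X)"
      using e_X a_X C mult_left_mono[of "X + norm a" "X + Cs * X" Cu] by linarith
    then show ?thesis
      using uv le_X de_X by linarith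
  qed
  finally have "norm_V d k (u - uh) \<le> (2 + Cu * (1 + Cs) + Cd) * X"
    by (simp add: algebra_simps)
  then have "norm_V d (k - 1) (\<sigma> - \<sigma>h) + norm_V d k (u - uh) + norm (p - ph)
      \<le> (2 + Cs) * X + (2 + Cu * (1 + Cs) + Cd) * X + Cp * X"
    using \<sigma>_X p_X by linarith
  also have "\<dots> = (2 + Cs + (2 + Cu * (1 + Cs) + Cd) + Cp) * X"
    by (simp only: distrib_right)
  also have "2 + Cs + (2 + Cu * (1 + Cs) + Cd) + Cp = stability_constant c L"
    by (simp only: stability_constant_def Let_def Cs_def Cu_def Cd_def Cp_def)
  finally show ?thesis
    by (simp only: X_def Es_def Eu_def Ep_def Eb_def)
qed

lemma quasi_optimality:
  assumes sol: "mixed_solution d V k f \<sigma> u p"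
    and solh: "mixed_solution d Vh k f \<sigma>h uh ph"
  shows "norm_V d (k - 1) (\<sigma> - \<sigma>h) + norm_V d k (u - uh) + norm (p - ph)
    \<le> stability_constant c L *
      ((INF \<tau>\<in>Vh (k - 1). norm_V d (k - 1) (\<sigma> - \<tau>))
       + (INF v\<in>Vh k. norm_V d k (u - v))
       + (INF q\<in>Vh k. norm_V d k (p - q))
       + gap * (INF v\<in>Vh k. norm_V d k (orth_proj (boundaries d V k) u - v)))"
    (is "?E \<le> ?C * (?a + ?b + ?c + gap * ?e)")
proof (rule field_le_epsilon)
  fix \<epsilon> :: real assume "0 < \<epsilon>"
  have C: "0 \<le> ?C"
    by (rule stability_constant_nonneg[OF c_nonneg L_nonneg])
  \<comment> \<open>The slack \<open>\<delta>\<close> enters three times plainly and once multiplied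
    by \<open>gap\<close>. Using \<open>?C + 1\<close> keeps \<open>D\<close> positive without a
    positivity proof for \<open>?C\<close>.\<close>
  define D where "D = (?C + 1) * (3 + gap)"
  have pos: "0 < D"
    unfolding D_def using C gap_nonneg by (intro mult_pos_pos) auto
  define \<delta> where "\<delta> = \<epsilon> / D"
  then have \<delta>: "0 < \<delta>"
    using \<open>0 < \<epsilon>\<close> pos by (simp add: \<delta>_def)
  have ne: "Vh j \<noteq> {}" for j
    using subspace_0[OF subspace_Vh] by blast
  have approx: "\<exists>x\<in>Vh j. norm_V d j (z - x) < (INF x\<in>Vh j. norm_V d j (z - x)) + \<delta>" for j z
    by (rule INF_approx[OF ne norm_V_nonneg \<delta>])
  obtain \<tau> where \<tau>: "\<tau> \<in> Vh (k - 1)" "norm_V d (k - 1) (\<sigma> - \<tau>) < ?a + \<delta>"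
    using approx by blast
  obtain v where v: "v \<in> Vh k" "norm_V d k (u - v) < ?b + \<delta>"
    using approx by blast
  obtain q where q: "q \<in> Vh k" "norm_V d k (p - q) < ?c + \<delta>"
    using approx by blast
  obtain w where w: "w \<in> Vh k" "norm_V d k (orth_proj (boundaries d V k) u - w) < ?e + \<delta>"
    using approx by blast
  have "?E \<le> ?C * (norm_V d (k - 1) (\<sigma> - \<tau>) + norm_V d k (u - v) + norm_V d k (p - q)
      + gap * norm_V d k (orth_proj (boundaries d V k) u - w))"
    by (rule error_estimate[OF sol solh \<tau>(1) v(1) q(1) w(1)])
  also have "\<dots> \<le> ?C * ((?a + \<delta>) + (?b + \<delta>) + (?c + \<delta>) + gap * (?e + \<delta>))"
    using \<tau> v q w gap_nonneg by (intro mult_left_mono add_mono C) auto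
  also have "\<dots> = ?C * (?a + ?b + ?c + gap * ?e) + ?C * (3 + gap) * \<delta>"
    by (simp add: algebra_simps)
  also have "\<dots> \<le> ?C * (?a + ?b + ?c + gap * ?e) + D * \<delta>"
    unfolding D_def using \<delta> gap_nonneg by (intro add_left_mono mult_right_mono) auto
  also have "D * \<delta> = \<epsilon>"
    using pos by (simp add: \<delta>_def)
  finally show "?E \<le> ?C * (?a + ?b + ?c + gap * ?e) + \<epsilon>" .
qed

end

section \<open>Uniformity of the constants over the family\<close>

theorem theorem3p9:
  fixes W V :: "int \<Rightarrow> 'a::real_inner set"
    and d :: "int \<Rightarrow> 'a \<Rightarrow> 'a"
    and Vh :: "'h \<Rightarrow> int \<Rightarrow> 'a set"
    and \<pi> :: "'h \<Rightarrow> int \<Rightarrow> 'a \<Rightarrow> 'a"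
    and k :: int
  assumes "closed_hilbert_complex W V d"
    and "\<And>h. fin_dim_subcomplex W V d (Vh h)"
    and "\<And>h. cochain_projection W V d (Vh h) (\<pi> h)"
    and "uniformly_V_bounded V d \<pi>"
  shows "\<exists>C::real. \<forall>h f \<sigma> u p \<sigma>h uh ph.
    f \<in> W k \<longrightarrow>
    mixed_solution d V k f \<sigma> u p \<longrightarrow>
    mixed_solution d (Vh h) k f \<sigma>h uh ph \<longrightarrow>
    norm_V d (k - 1) (\<sigma> - \<sigma>h) + norm_V d k (u - uh) + norm (p - ph)
      \<le> C * ((INF \<tau>\<in>Vh h (k - 1). norm_V d (k - 1) (\<sigma> - \<tau>))
           + (INF v\<in>Vh h k. norm_V d k (u - v))
           + (INF q\<in>Vh h k. norm_V d k (p - q))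
           + harmonic_gap V d (\<pi> h) k
             * (INF v\<in>Vh h k. norm_V d k (orth_proj (boundaries d V k) u - v)))"
proof -
  interpret closed_hilbert_complex W V d
    by fact
  \<comment> \<open>The constant in \<open>uniformly_V_bounded\<close> carries no sign, so it is
    replaced by its absolute value.\<close>
  have bounded: "\<exists>c\<ge>0. \<forall>h. \<forall>v\<in>V j. norm_V d j (\<pi> h j v) \<le> c * norm_V d j v" for j
  proof -
    obtain c where c: "\<And>h v. v \<in> V j \<Longrightarrow> norm_V d j (\<pi> h j v) \<le> c * norm_V d j v"
      using assms(4) unfolding uniformly_V_bounded_def by metis
    have "c * norm_V d j v \<le> \<bar>c\<bar> * norm_V d j v" for v
      by (intro mult_right_mono norm_V_nonneg) simp
    from order_trans[OF c this] show ?thesis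
      by (intro exI[of _ "\<bar>c\<bar>"]) simp
  qed
  then obtain c where c: "\<And>j. 0 \<le> c j"
      "\<And>j h v. v \<in> V j \<Longrightarrow> norm_V d j (\<pi> h j v) \<le> c j * norm_V d j v"
    by metis
  obtain K where K: "\<And>j. 0 \<le> K j"
      "\<And>j b. b \<in> d j ` V j \<Longrightarrow> \<exists>z\<in>V j. d j z = b \<and> norm_V d j z \<le> K j * norm b"
    using bounded_lifting by metis
  \<comment> \<open>A sum of nonnegative terms dominates the lifting constants of both degrees at
    once, and it is fixed before any \<open>h\<close> is chosen.\<close>
  define L where "L = c (k - 1) * K (k - 1) + c k * K k"
  have L: "0 \<le> L" "c j * K j \<le> L" if "j \<in> {k - 1, k}" for j
    using that c(1) K(1) by (auto simp: L_def)
  have stable: "stable_cochain_projection W V d (Vh h) (\<pi> h) k (c k) L" for h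
  proof -
    interpret cochain_projection W V d "Vh h" "\<pi> h"
      by fact
    show ?thesis
    proof (unfold_locales, goal_cases)
      \<comment> \<open>The \<open>lift\<close> assumption of the locale: preimages in
        \<open>V j\<close> are moved into the subcomplex by the projection.\<close>
      case (4 j v)
      obtain w where w: "w \<in> Vh h j" "d j w = d j v" "norm w \<le> c j * K j * norm (d j v)"
        using discrete_lifting[OF c(1)[of j] c(2) K(2) 4(2)] by fast
      have "c j * K j * norm (d j v) \<le> L * norm (d j v)"
        by (rule mult_right_mono[OF L(2)[OF 4(1)] norm_ge_zero])
      then show ?case
        using w by (intro bexI[of _ w]) auto
    qed (fact c(1), rule L(1)[of k], simp, fact c(2))
  qed
  show ?thesis
  proof (intro exI[of _ "stability_constant (c k) L"] allI impI)
    fix h f \<sigma> u p \<sigma>h uh ph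
    assume sol: "mixed_solution d V k f \<sigma> u p" "mixed_solution d (Vh h) k f \<sigma>h uh ph"
    show "norm_V d (k - 1) (\<sigma> - \<sigma>h) + norm_V d k (u - uh) + norm (p - ph)
      \<le> stability_constant (c k) L *
        ((INF \<tau>\<in>Vh h (k - 1). norm_V d (k - 1) (\<sigma> - \<tau>))
         + (INF v\<in>Vh h k. norm_V d k (u - v))
         + (INF q\<in>Vh h k. norm_V d k (p - q))
         + harmonic_gap V d (\<pi> h) k
           * (INF v\<in>Vh h k. norm_V d k (orth_proj (boundaries d V k) u - v)))"
      by (rule stable_cochain_projection.quasi_optimality[OF stable sol])
  qed
qed

end
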